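(* Let $\gamma>0$ be such that $A_\gamma:=A-\gamma I$ is invertible, and put $Y_\gamma=CA_\gamma^{-1}B$ and $\widehat Y_\gamma=\sqrt{2\gamma}\,CA_\gamma^{-1}\ltimes\widehat B$. For $$X=2\gamma A_\gamma^{-\mathrm T}C^{\mathrm T}(I+Y_\gamma Y_\gamma^{\mathrm T})^{-1}CA_\gamma^{-1}$$ we have $$\mathcal{C}(X)=\widetilde C^{\mathrm T}\widetilde C,\qquad \widetilde C=\begin{bmatrix} C+2\gamma(I+Y_\gamma Y_\gamma^{\mathrm T})^{-1}CA_\gamma^{-1} \\ \widetilde M^{-1}\left(\sqrt{2\gamma}\,CA_\gamma^{-1}\ltimes\widehat A-\widehat Y_\gamma B^{\mathrm T}X\right) \end{bmatrix}\in\mathbb{R}^{rl\times n},$$ where $\widetilde M\in\mathbb{R}^{(r-1)l\times(r-1)l}$ is any square matrix satisfying $\widetilde M\widetilde M^{\mathrm T}=I+Y_\gamma Y_\gamma^{\mathrm T}\otimes I_{r-1}+\widehat Y_\gamma\widehat Y_\gamma^{\mathrm T}$, and $l$ is the number of rows of $C$. Moreover, with $P_X$ and $L_X$ as defined in the context, $$L_X^{\mathrm T}=P_X^{-\mathrm T}\,\widehat Y_\gamma^{\mathrm T}\ltimes(I+Y_\gamma Y_\gamma^{\mathrm T})^{-1}\ltimes\left(\sqrt{2\gamma}\,CA_\gamma^{-1}\ltimes\widehat A-\widehat Y_\gamma B^{\mathrm T}X\right)+P_XB^{\mathrm T}X.$$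
   Context: All matrices are real; $M\succ0$ ($M\succeq0$) means $M$ is symmetric positive definite (semi-definite); $M^{-\mathrm T}=(M^{-1})^{\mathrm T}$; $\otimes$ is the Kronecker product. Left semi-tensor product: for $U\in\mathbb{R}^{m_1\times n_1}$ and $V\in\mathbb{R}^{p_1\times q_1}$, $U\ltimes V:=(U\otimes I_{p_1/n_1})V$ if $n_1\mid p_1$, and $U\ltimes V:=U(V\otimes I_{n_1/p_1})$ if $p_1\mid n_1$. It is associative and coincides with the ordinary product when $n_1=p_1$. Data: integers $r\ge1$, $n,m,l\ge1$; matrices $A_i\in\mathbb{R}^{n\times n}$, $B_i\in\mathbb{R}^{n\times m}$ for $i=0,\dots,r-1$; $R\in\mathbb{R}^{m\times m}$, $L\in\mathbb{R}^{n\times m}$, $Q\in\mathbb{R}^{n\times n}$ with $\begin{bmatrix} Q & L \\ L^{\mathrm T} & R \end{bmatrix}\succeq0$. Fix $P\in\mathbb{R}^{m\times m}$ with $P^{\mathrm T}P=R$ and $C\in\mathbb{R}^{l\times n}$ with $C^{\mathrm T}C=Q-LR^{-1}L^{\mathrm T}$. Let $\Pi$ be the permutation matrix of size $(r-1)n$ satisfying $\Pi^{\mathrm T}(Z\otimes I_{r-1})\Pi=I_{r-1}\otimes Z$ for all $Z\in\mathbb{R}^{n\times n}$. Put $$A=A_0-B_0R^{-1}L^{\mathrm T},\qquad B=B_0P^{-1},$$ $$\widehat A=\Pi\left(\begin{bmatrix} A_1 \\ \vdots \\ A_{r-1} \end{bmatrix}-\begin{bmatrix} B_1 \\ \vdots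 \\ B_{r-1} \end{bmatrix}R^{-1}L^{\mathrm T}\right)\in\mathbb{R}^{(r-1)n\times n},\qquad \widehat B=\Pi\begin{bmatrix} B_1 \\ \vdots \\ B_{r-1} \end{bmatrix}P^{-1}\in\mathbb{R}^{(r-1)n\times m}.$$ (If $r=1$, all terms and blocks involving $\widehat A,\widehat B$ are absent.) Standing assumptions: $R\succ0$; the pair $(\{A_i\}_{i=0}^{r-1},\{B_i\}_{i=0}^{r-1})$ is stabilizable, i.e. there is a matrix $F$ such that the linear operator $S\mapsto (A_0+B_0F)^{\mathrm T}S+S(A_0+B_0F)+\sum_{i=1}^{r-1}(A_i+B_iF)^{\mathrm T}S(A_i+B_iF)$ on symmetric matrices is exponentially stable (all its eigenvalues have negative real part); and $(\{A_i\}_{i=0}^{r-1},C)$ is detectable, i.e. $(\{A_i^{\mathrm T}\}_{i=0}^{r-1},\{C_i^{\mathrm T}\}_{i=0}^{r-1})$ is stabilizable with $C_0=C$ and $C_i=0$ for $i\ge1$. Residual operator: for symmetric $Z\in\mathbb{R}^{n\times n}$ with $I+\widehat B^{\mathrm T}\ltimes Z\ltimes\widehat B$ invertible, $$\mathcal{C}(Z)=C^{\mathrm T}C+A^{\mathrm T}Z+ZA+\widehat A^{\mathrm T}\ltimes Z\ltimes\widehat A-(ZB+\widehat A^{\mathrm T}\ltimes Z\ltimes\widehat B)(I+\widehat B^{\mathrm T}\ltimes Z\ltimes\widehat B)^{-1}(ZB+\widehat A^{\mathrm T}\ltimes Z\ltimes\widehat B)^{\mathrm T}.$$ For $X\succeq0$: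 $R_X=I+\widehat B^{\mathrm T}\ltimes X\ltimes\widehat B$; $P_X$ is any square matrix with $P_X^{\mathrm T}P_X=R_X$; $B_X=BP_X^{-1}$, $\widehat B_X=\widehat BP_X^{-1}$; and $L_X^{\mathrm T}=B_X^{\mathrm T}X+\widehat B_X^{\mathrm T}\ltimes X\ltimes\widehat A$. *)

theory Defs
  imports
    Complex_Main
    "HOL-Combinatorics.Permutations"
    "Jordan_Normal_Form.Matrix"
    "Jordan_Normal_Form.Gauss_Jordan_Elimination"
begin

definition pos_semidef :: "real mat \<Rightarrow> bool" where
  "pos_semidef M \<longleftrightarrow> square_mat M \<and> M\<^sup>T = M \<and>
     (\<forall>v \<in> carrier_vec (dim_row M). 0 \<le> v \<bullet> (M *\<^sub>v v))"

definition pos_def :: "real mat \<Rightarrow> bool" where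
  "pos_def M \<longleftrightarrow> square_mat M \<and> M\<^sup>T = M \<and>
     (\<forall>v \<in> carrier_vec (dim_row M). v \<noteq> 0\<^sub>v (dim_row M) \<longrightarrow> 0 < v \<bullet> (M *\<^sub>v v))"

text \<open>Unspecified when the argument is not invertible.\<close>
definition minv :: "'a :: field mat \<Rightarrow> 'a mat" where
  "minv M = the (mat_inverse M)"

definition kron :: "'a :: semiring_1 mat \<Rightarrow> 'a mat \<Rightarrow> 'a mat" where
  "kron U V = mat (dim_row U * dim_row V) (dim_col U * dim_col V)
     (\<lambda>(i, j). U $$ (i div dim_row V, j div dim_col V) * V $$ (i mod dim_row V, j mod dim_col V))"

text \<open>Left semi-tensor product. The first case agrees with the two divisibility cases for
  equal positive inner dimensions. It is listed separately for the inner dimension 0, where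
  \<open>0 div 0 = 0\<close> would yield a wrongly sized identity factor: matrices with 0 rows or columns
  encode the absent blocks for \<open>r = 1\<close>.\<close>
definition stp :: "'a :: semiring_1 mat \<Rightarrow> 'a mat \<Rightarrow> 'a mat"  (infixl "\<ltimes>" 70) where
  "U \<ltimes> V =
     (if dim_col U = dim_row V then U * V
      else if dim_col U dvd dim_row V then kron U (1\<^sub>m (dim_row V div dim_col U)) * V
      else if dim_row V dvd dim_col U then U * kron V (1\<^sub>m (dim_col U div dim_row V))
      else undefined)"

definition permutation_mat :: "nat \<Rightarrow> real mat \<Rightarrow> bool" where
  "permutation_mat N M \<longleftrightarrow>
     (\<exists>p. p permutes {..<N} \<and> M = mat N N (\<lambda>(i, j). if i = p j then 1 else 0))"

text \<open>The matrices \<open>M 1, \<dots>, M (r - 1)\<close>, each with \<open>c\<close> columns, stacked on top of each other.\<close>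
definition stack_rows :: "nat \<Rightarrow> nat \<Rightarrow> (nat \<Rightarrow> real mat) \<Rightarrow> real mat" where
  "stack_rows r c M = foldr (@\<^sub>r) (map M [1..<r]) (0\<^sub>m 0 c)"

definition lyap_op :: "nat \<Rightarrow> (nat \<Rightarrow> 'a :: comm_ring_1 mat) \<Rightarrow> 'a mat \<Rightarrow> 'a mat" where
  "lyap_op r K S = foldr (+) (map (\<lambda>i. (K i)\<^sup>T * S * K i) [1..<r]) ((K 0)\<^sup>T * S + S * K 0)"

text \<open>The operator \<open>lyap_op r K\<close> on real symmetric matrices is exponentially stable. Its
  eigenvalues are those of its complexification, which acts on the complex matrices that are
  symmetric (not Hermitian).\<close>
definition lyap_exp_stable :: "nat \<Rightarrow> nat \<Rightarrow> (nat \<Rightarrow> real mat) \<Rightarrow> bool" where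
  "lyap_exp_stable n r K \<longleftrightarrow>
     (\<forall>z :: complex. \<forall>S \<in> carrier_mat n n.
        S\<^sup>T = S \<and> S \<noteq> 0\<^sub>m n n \<and>
        lyap_op r (\<lambda>i. map_mat complex_of_real (K i)) S = z \<cdot>\<^sub>m S \<longrightarrow> Re z < 0)"

definition stabilizable ::
  "nat \<Rightarrow> nat \<Rightarrow> nat \<Rightarrow> (nat \<Rightarrow> real mat) \<Rightarrow> (nat \<Rightarrow> real mat) \<Rightarrow> bool" where
  "stabilizable n m r A B \<longleftrightarrow>
     (\<exists>F \<in> carrier_mat m n. lyap_exp_stable n r (\<lambda>i. A i + B i * F))"

definition detectable ::
  "nat \<Rightarrow> nat \<Rightarrow> nat \<Rightarrow> (nat \<Rightarrow> real mat) \<Rightarrow> real mat \<Rightarrow> bool" where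
  "detectable n l r A C \<longleftrightarrow>
     stabilizable n l r (\<lambda>i. (A i)\<^sup>T) (\<lambda>i. (if i = 0 then C else 0\<^sub>m l n)\<^sup>T)"

definition R_mat :: "real mat \<Rightarrow> real mat \<Rightarrow> real mat" where
  "R_mat Bh Z = 1\<^sub>m (dim_col Bh) + Bh\<^sup>T \<ltimes> Z \<ltimes> Bh"

definition residual ::
  "real mat \<Rightarrow> real mat \<Rightarrow> real mat \<Rightarrow> real mat \<Rightarrow> real mat \<Rightarrow> real mat \<Rightarrow> real mat" where
  "residual C A B Ah Bh Z =
     C\<^sup>T * C + A\<^sup>T * Z + Z * A + Ah\<^sup>T \<ltimes> Z \<ltimes> Ah
     - (Z * B + Ah\<^sup>T \<ltimes> Z \<ltimes> Bh) * minv (R_mat Bh Z) * (Z * B + Ah\<^sup>T \<ltimes> Z \<ltimes> Bh)\<^sup>T"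

definition residual_domain :: "nat \<Rightarrow> real mat \<Rightarrow> real mat \<Rightarrow> bool" where
  "residual_domain n Bh Z \<longleftrightarrow>
     Z \<in> carrier_mat n n \<and> Z\<^sup>T = Z \<and> invertible_mat (R_mat Bh Z)"

text \<open>The matrix \<open>L\<^sub>X\<close>, given by its transpose \<open>B\<^sub>X\<^sup>T X + Bh\<^sub>X\<^sup>T \<ltimes> X \<ltimes> Ah\<close> with
  \<open>B\<^sub>X = B P\<^sub>X\<^sup>-\<^sup>1\<close> and \<open>Bh\<^sub>X = Bh P\<^sub>X\<^sup>-\<^sup>1\<close>.\<close>
definition L_mat :: "real mat \<Rightarrow> real mat \<Rightarrow> real mat \<Rightarrow> real mat \<Rightarrow> real mat \<Rightarrow> real mat" where
  "L_mat B Ah Bh X PX =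
     ((B * minv PX)\<^sup>T * X + (Bh * minv PX)\<^sup>T \<ltimes> X \<ltimes> Ah)\<^sup>T"

end

theory Submission
  imports Defs "Jordan_Normal_Form.Determinant"
begin

text \<open>
  Write \<open>G\<close> for the inverse of \<open>A\<gamma>\<close>, \<open>T = sqrt (2 \<gamma>) C G\<close>, \<open>s = r - 1\<close>, and let
  \<open>K\<close> and \<open>V\<close> be the Kronecker products of \<open>T\<close> and \<open>W\<close> with the identity of size \<open>s\<close>. Then
  \<open>X = T\<^sup>T W T\<close>, so every expression \<open>U\<^sup>T \<ltimes> X \<ltimes> Z\<close> factors as \<open>(K U)\<^sup>T V (K Z)\<close>. With
  \<open>N = K Ah\<close>, \<open>b = X B\<close> and \<open>R = I + Yh\<^sup>T V Yh\<close> the residual therefore reads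
  \<open>C\<^sup>T C + A\<^sup>T X + X A + N\<^sup>T V N - (b + N\<^sup>T V Yh) R\<^sup>-\<^sup>1 (b + N\<^sup>T V Yh)\<^sup>T\<close>.

  Its linear part equals \<open>U\<^sup>T U + b b\<^sup>T\<close>, where \<open>U\<close> is the upper block of the claimed
  factor (\<open>shifted_lyapunov\<close>): since \<open>A = G\<^sup>-\<^sup>1 + \<gamma> I\<close>, both sides are combinations of terms in
  \<open>C\<close> and \<open>C G\<close>, and they agree because \<open>W - W W = W Y Y\<^sup>T W\<close>.

  The matrix \<open>H = N - Yh b\<^sup>T\<close> is chosen to complete the square: the correction
  \<open>b + N\<^sup>T V Yh\<close> equals \<open>b R + H\<^sup>T V Yh\<close>, all terms containing \<open>b\<close> cancel, and
  \<open>H\<^sup>T (V - V Yh R\<^sup>-\<^sup>1 Yh\<^sup>T V) H\<close> is left over (\<open>complete_square\<close>). By the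
  Sherman--Morrison--Woodbury formula (\<open>woodbury\<close>) the middle matrix is the inverse of
  \<open>V\<^sup>-\<^sup>1 + Yh Yh\<^sup>T = M M\<^sup>T\<close>, so the remainder is the Gram matrix of \<open>M\<^sup>-\<^sup>1 H\<close>, the lower block.
  The formula for \<open>L\<^sub>X\<close> is the same rewriting of \<open>b + N\<^sup>T V Yh\<close>, followed by
  \<open>R = P\<^sub>X\<^sup>T P\<^sub>X\<close>.

  The matrices \<open>I + Y Y\<^sup>T\<close>, \<open>R\<close> and \<open>M M\<^sup>T\<close> are invertible because each is the identity plus a
  positive semidefinite matrix; \<open>M\<close> and \<open>P\<^sub>X\<close> are then invertible as square factors.
\<close>

section \<open>Algebra of rectangular matrices\<close>

text \<open>The side conditions of the following rules are equations between dimensions, not carrier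
  memberships: the simplifier can discharge them from the dimensions of the atoms, without having
  to guess the intermediate dimensions. Together they expand a matrix expression into a sum of
  right-associated products. Two such sums are then compared entry by entry, with products kept as
  atoms (hence the recurring \<open>del: index_mult_mat(1)\<close>), which reduces matrix identities to
  identities in the coefficient ring.\<close>

lemma mult_assoc_dim: "dim_col A = dim_row B \<Longrightarrow> dim_col B = dim_row D \<Longrightarrow>
    A * B * D = A * (B * (D :: 'a :: semiring_0 mat))"
  by (rule assoc_mult_mat[of _ "dim_row A" "dim_col A" _ "dim_col B" _ "dim_col D"]) auto

lemma mult_add_dim: "dim_col A = dim_row B \<Longrightarrow> dim_row B = dim_row D \<Longrightarrow> dim_col B = dim_col D \<Longrightarrow>
    A * (B + D) = A * B + A * (D :: 'a :: semiring_0 mat)"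
  by (rule mult_add_distrib_mat[of _ "dim_row A" "dim_col A" _ "dim_col B"]) auto

lemma add_mult_dim: "dim_col B = dim_row A \<Longrightarrow> dim_row B = dim_row D \<Longrightarrow> dim_col B = dim_col D \<Longrightarrow>
    (B + D) * A = B * A + D * (A :: 'a :: semiring_0 mat)"
  by (rule add_mult_distrib_mat[of _ "dim_row B" "dim_col B" _ _ "dim_col A"]) auto

lemma mult_minus_dim: "dim_col A = dim_row B \<Longrightarrow> dim_row B = dim_row D \<Longrightarrow> dim_col B = dim_col D \<Longrightarrow>
    A * (B - D) = A * B - A * (D :: 'a :: ring mat)"
  by (rule mult_minus_distrib_mat[of _ "dim_row A" "dim_col A" _ "dim_col B"]) auto

lemma minus_mult_dim: "dim_col B = dim_row A \<Longrightarrow> dim_row B = dim_row D \<Longrightarrow> dim_col B = dim_col D \<Longrightarrow>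
    (B - D) * A = B * A - D * (A :: 'a :: ring mat)"
  by (rule minus_mult_distrib_mat[of _ "dim_row B" "dim_col B" _ _ "dim_col A"]) auto

lemma smult_mult_dim: "dim_col A = dim_row B \<Longrightarrow> (k \<cdot>\<^sub>m A) * B = k \<cdot>\<^sub>m (A * (B :: 'a :: comm_semiring_0 mat))"
  by (rule mult_smult_assoc_mat[of _ "dim_row A" "dim_col A" _ "dim_col B"]) auto

lemma mult_smult_dim: "dim_col A = dim_row B \<Longrightarrow> A * (k \<cdot>\<^sub>m B) = k \<cdot>\<^sub>m (A * (B :: 'a :: comm_semiring_0 mat))"
  by (rule mult_smult_distrib[of _ "dim_row A" "dim_col A" _ "dim_col B"]) auto

lemma smult_add_dim: "dim_row A = dim_row B \<Longrightarrow> dim_col A = dim_col B \<Longrightarrow>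
    k \<cdot>\<^sub>m (A + B) = k \<cdot>\<^sub>m A + k \<cdot>\<^sub>m (B :: 'a :: ring mat)"
  by (rule eq_matI) (auto simp: distrib_left)

lemma smult_minus_dim: "dim_row A = dim_row B \<Longrightarrow> dim_col A = dim_col B \<Longrightarrow>
    k \<cdot>\<^sub>m (A - B) = k \<cdot>\<^sub>m A - k \<cdot>\<^sub>m (B :: 'a :: ring mat)"
  by (rule eq_matI) (auto simp: right_diff_distrib)

lemma smult_smult_mat: "k \<cdot>\<^sub>m (j \<cdot>\<^sub>m A) = (k * j) \<cdot>\<^sub>m (A :: 'a :: semigroup_mult mat)"
  by (rule eq_matI) (auto simp: mult.assoc)

lemma one_mult_dim: "dim_row A = k \<Longrightarrow> 1\<^sub>m k * A = (A :: 'a :: semiring_1 mat)"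
  by (rule left_mult_one_mat) auto

lemma mult_one_dim: "dim_col A = k \<Longrightarrow> A * 1\<^sub>m k = (A :: 'a :: semiring_1 mat)"
  by (rule right_mult_one_mat) auto

lemma transpose_mult_dim: "dim_col A = dim_row B \<Longrightarrow> (A * B)\<^sup>T = B\<^sup>T * (A :: 'a :: comm_semiring_0 mat)\<^sup>T"
  by (rule transpose_mult[of _ "dim_row A" "dim_col A" _ "dim_col B"]) auto

lemma transpose_add_dim: "dim_row A = dim_row B \<Longrightarrow> dim_col A = dim_col B \<Longrightarrow> (A + B)\<^sup>T = A\<^sup>T + B\<^sup>T"
  by (rule eq_matI) auto

lemma transpose_minus_dim: "dim_row A = dim_row B \<Longrightarrow> dim_col A = dim_col B \<Longrightarrow> (A - B)\<^sup>T = A\<^sup>T - B\<^sup>T"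
  by (rule eq_matI) auto

lemma transpose_smult_mat: "(k \<cdot>\<^sub>m A)\<^sup>T = k \<cdot>\<^sub>m A\<^sup>T"
  by (rule eq_matI) auto

lemmas mat_expand = mult_assoc_dim mult_add_dim add_mult_dim mult_minus_dim minus_mult_dim
  smult_mult_dim mult_smult_dim smult_add_dim smult_minus_dim smult_smult_mat
  one_mult_dim mult_one_dim
  transpose_mult_dim transpose_add_dim transpose_minus_dim transpose_smult_mat

text \<open>Needed because right-association hides a product \<open>U * V\<close> that is followed by a third factor.\<close>

lemma mult_cancel_left_inverse:
  assumes "U * V = 1\<^sub>m k" "dim_col U = dim_row V" "dim_row D = k"
  shows "U * (V * D) = (D :: 'a :: semiring_1 mat)"
proof -
  have "dim_col V = k" using assms(1) by (metis index_mult_mat(3) index_one_mat(3))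
  then have "U * (V * D) = U * V * D" using assms(2,3) by (simp add: mult_assoc_dim)
  also have "\<dots> = D" using assms(3) by (simp only: assms(1) one_mult_dim)
  finally show ?thesis .
qed

section \<open>Invertibility and positive semidefiniteness\<close>

lemma invertible_mat_iff_det:
  assumes "(A :: 'a :: field mat) \<in> carrier_mat n n"
  shows "invertible_mat A \<longleftrightarrow> det A \<noteq> 0"
proof
  assume "invertible_mat A"
  then obtain B where AB: "A * B = 1\<^sub>m n" and BA: "B * A = 1\<^sub>m (dim_row B)"
    using assms unfolding invertible_mat_def inverts_mat_def by auto
  have "dim_col B = n" using AB by (metis index_mult_mat(3) index_one_mat(3))
  moreover have "dim_row B = n" using BA assms
    by (metis carrier_matD(2) index_mult_mat(3) index_one_mat(3))
  ultimately have B: "B \<in> carrier_mat n n" by auto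
  show "det A \<noteq> 0" using det_mult[OF assms B] AB by auto
next
  assume "det A \<noteq> 0"
  from det_non_zero_imp_unit[OF assms this] obtain B where
    "B \<in> carrier_mat n n" "A * B = 1\<^sub>m n" "B * A = 1\<^sub>m n"
    unfolding Units_def ring_mat_def by auto
  then show "invertible_mat A" using assms
    unfolding invertible_mat_def inverts_mat_def by auto
qed

lemma minv:
  assumes A: "A \<in> carrier_mat n n" and inv: "invertible_mat A"
  shows "minv A \<in> carrier_mat n n" "A * minv A = 1\<^sub>m n" "minv A * A = 1\<^sub>m n"
proof -
  have "det A \<noteq> 0" using invertible_mat_iff_det[OF A] inv by simp
  then have "A \<in> Units (ring_mat TYPE('a) n undefined)" by (rule det_non_zero_imp_unit[OF A])
  then obtain B where "mat_inverse A = Some B"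
    using mat_inverse(1)[OF A, of undefined] by (cases "mat_inverse A") auto
  with mat_inverse(2)[OF A this]
  show "minv A \<in> carrier_mat n n" "A * minv A = 1\<^sub>m n" "minv A * A = 1\<^sub>m n"
    by (auto simp: minv_def)
qed

lemma invertible_of_invertible_mult:
  assumes "A \<in> carrier_mat n n" "B \<in> carrier_mat n n" "invertible_mat (A * (B :: 'a :: field mat))"
  shows "invertible_mat A" "invertible_mat B"
proof -
  have "det (A * B) \<noteq> 0" using assms invertible_mat_iff_det[of "A * B" n] by auto
  then show "invertible_mat A" "invertible_mat B"
    using assms invertible_mat_iff_det det_mult[OF assms(1,2)] by auto
qed

lemma pos_def_invertible:
  assumes "pos_def M" "M \<in> carrier_mat n n"
  shows "invertible_mat M"
proof -
  have "det M \<noteq> 0"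
  proof
    assume "det M = 0"
    then obtain v where v: "v \<in> carrier_vec n" "v \<noteq> 0\<^sub>v n" "M *\<^sub>v v = 0\<^sub>v n"
      using det_0_iff_vec_prod_zero_field[OF assms(2)] by auto
    then have "v \<bullet> (M *\<^sub>v v) = 0" by simp
    moreover have "0 < v \<bullet> (M *\<^sub>v v)" using assms v(1,2) by (auto simp: pos_def_def)
    ultimately show False by simp
  qed
  then show ?thesis using invertible_mat_iff_det[OF assms(2)] by simp
qed

lemma pos_semidef_one: "pos_semidef (1\<^sub>m n)"
  by (auto simp: pos_semidef_def scalar_prod_def sum_nonneg)

lemma pos_semidef_congruence:
  assumes M: "pos_semidef M" and d: "dim_row G = dim_row M"
  shows "pos_semidef (G\<^sup>T * M * G)"
proof -
  have sq: "dim_col M = dim_row M" "M\<^sup>T = M" using M by (auto simp: pos_semidef_def)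
  have "0 \<le> v \<bullet> ((G\<^sup>T * M * G) *\<^sub>v v)" if v: "v \<in> carrier_vec (dim_col G)" for v
  proof -
    define w where "w = G *\<^sub>v v"
    have w: "w \<in> carrier_vec (dim_row M)" using d by (simp add: w_def carrier_vecI)
    have G: "G \<in> carrier_mat (dim_row M) (dim_col G)" using d by (intro carrier_matI) simp_all
    have Mc: "M \<in> carrier_mat (dim_row M) (dim_row M)" using sq(1) by (intro carrier_matI) simp_all
    have GT: "G\<^sup>T \<in> carrier_mat (dim_col G) (dim_row M)" by (rule transpose_carrier_mat[THEN iffD2, OF G])
    have Mw: "M *\<^sub>v w \<in> carrier_vec (dim_row M)" by (rule mult_mat_vec_carrier[OF Mc w])
    have "(G\<^sup>T * M * G) *\<^sub>v v = (G\<^sup>T * M) *\<^sub>v w"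
      unfolding w_def by (rule assoc_mult_mat_vec[OF mult_carrier_mat[OF GT Mc] G v])
    also have "\<dots> = G\<^sup>T *\<^sub>v (M *\<^sub>v w)" by (rule assoc_mult_mat_vec[OF GT Mc w])
    finally have "v \<bullet> ((G\<^sup>T * M * G) *\<^sub>v v) = v \<bullet> (G\<^sup>T *\<^sub>v (M *\<^sub>v w))" by (rule arg_cong)
    also have "\<dots> = (G\<^sup>T *\<^sub>v (M *\<^sub>v w)) \<bullet> v"
      by (rule comm_scalar_prod[OF v mult_mat_vec_carrier[OF GT Mw]])
    also have "\<dots> = (M *\<^sub>v w) \<bullet> w"
      unfolding w_def by (rule transpose_vec_mult_scalar[OF G v Mw[unfolded w_def]])
    also have "\<dots> = w \<bullet> (M *\<^sub>v w)" by (rule comm_scalar_prod[OF Mw w])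
    also have "0 \<le> \<dots>" using M w unfolding pos_semidef_def by blast
    finally show ?thesis .
  qed
  then show ?thesis using d sq by (simp add: pos_semidef_def mat_expand)
qed

lemma pos_semidef_gram: "pos_semidef (G\<^sup>T * G)" "pos_semidef (G * G\<^sup>T)"
  using pos_semidef_congruence[OF pos_semidef_one, of G]
    pos_semidef_congruence[OF pos_semidef_one, of "G\<^sup>T"] by (simp_all add: mult_one_dim)

text \<open>\<open>W\<^sup>T\<close> is a left inverse of \<open>S\<^sup>T = S\<close>, and a left and a right inverse coincide.\<close>

lemma inverse_of_symmetric:
  assumes S: "S \<in> carrier_mat k k" "S\<^sup>T = S" and W: "W \<in> carrier_mat k k" "S * W = 1\<^sub>m k"
  shows "W\<^sup>T = (W :: 'a :: comm_semiring_1 mat)"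
proof -
  have "W\<^sup>T * S = (S * W)\<^sup>T" using S W(1) by (simp add: transpose_mult_dim)
  then have "W\<^sup>T * S = 1\<^sub>m k" using W(2) by simp
  then have "W\<^sup>T * (S * W) = W" using S W by (intro mult_cancel_left_inverse) auto
  then show ?thesis using W by (simp add: mult_one_dim)
qed

text \<open>The inverse is congruent to the matrix itself: \<open>W = W\<^sup>T S W\<close>.\<close>

lemma pos_semidef_inverse:
  assumes S: "pos_semidef S" "S \<in> carrier_mat k k" and W: "W \<in> carrier_mat k k" "S * W = 1\<^sub>m k"
  shows "pos_semidef W"
proof -
  have WT: "W\<^sup>T = W"
    using S(1) by (intro inverse_of_symmetric[OF S(2) _ W]) (simp add: pos_semidef_def)
  have "W\<^sup>T * S * W = W\<^sup>T * (S * W)" using S(2) W(1) by (intro mult_assoc_dim) simp_all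
  also have "\<dots> = W" using W(1) by (simp add: W(2) WT mult_one_dim)
  finally show ?thesis using pos_semidef_congruence[OF S(1), of W] S(2) W(1) by simp
qed

lemma pos_semidef_add:
  assumes "pos_semidef M" "pos_semidef N" "dim_row M = dim_row N"
  shows "pos_semidef (M + N)"
proof -
  have c: "M \<in> carrier_mat (dim_row N) (dim_row N)" "N \<in> carrier_mat (dim_row N) (dim_row N)"
    using assms by (auto simp: pos_semidef_def)
  have "0 \<le> v \<bullet> ((M + N) *\<^sub>v v)" if v: "v \<in> carrier_vec (dim_row N)" for v
  proof -
    have "v \<bullet> ((M + N) *\<^sub>v v) = v \<bullet> (M *\<^sub>v v) + v \<bullet> (N *\<^sub>v v)"
      unfolding add_mult_distrib_mat_vec[OF c v]
      by (rule scalar_prod_add_distrib[OF v mult_mat_vec_carrier[OF c(1) v] mult_mat_vec_carrier[OF c(2) v]])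
    moreover have "0 \<le> v \<bullet> (M *\<^sub>v v)" "0 \<le> v \<bullet> (N *\<^sub>v v)"
      using assms v unfolding pos_semidef_def by metis+
    ultimately show ?thesis by linarith
  qed
  then show ?thesis using assms unfolding pos_semidef_def by (simp add: transpose_add_dim)
qed

text \<open>The quadratic form of \<open>I + M\<close> is at least \<open>v \<bullet> v\<close>.\<close>

lemma one_plus_pos_semidef_invertible:
  assumes "pos_semidef M" "M \<in> carrier_mat n n"
  shows "invertible_mat (1\<^sub>m n + M)"
proof (rule pos_def_invertible)
  show "1\<^sub>m n + M \<in> carrier_mat n n" using assms by auto
  have "0 < v \<bullet> ((1\<^sub>m n + M) *\<^sub>v v)" if v: "v \<in> carrier_vec n" "v \<noteq> 0\<^sub>v n" for v
  proof -
    have "v \<bullet> ((1\<^sub>m n + M) *\<^sub>v v) = v \<bullet> v + v \<bullet> (M *\<^sub>v v)"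
      unfolding add_mult_distrib_mat_vec[OF one_carrier_mat assms(2) v(1)] one_mult_mat_vec[OF v(1)]
      by (rule scalar_prod_add_distrib[OF v(1) v(1) mult_mat_vec_carrier[OF assms(2) v(1)]])
    moreover have "0 \<le> v \<bullet> (M *\<^sub>v v)"
      using assms v(1) unfolding pos_semidef_def by (metis carrier_matD(1))
    moreover have "v \<bullet> v > 0"
    proof -
      obtain i where "i < n" "v $ i \<noteq> 0" using v by (metis carrier_vecD eq_vecI index_zero_vec)
      then show ?thesis using v by (auto simp: scalar_prod_def intro!: sum_pos2[of _ i])
    qed
    ultimately show ?thesis by simp
  qed
  then show "pos_def (1\<^sub>m n + M)" using assms by (auto simp: pos_def_def pos_semidef_def transpose_add_dim)
qed

section \<open>The Kronecker product with an identity factor\<close>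

lemma dim_kron [simp]: "dim_row (kron U V) = dim_row U * dim_row V" "dim_col (kron U V) = dim_col U * dim_col V"
  by (auto simp: kron_def)

lemma kron_one_right: "kron U (1\<^sub>m 1) = U"
  by (rule eq_matI) (auto simp: kron_def)

lemma kron_one_one: "kron (1\<^sub>m k) (1\<^sub>m s) = (1\<^sub>m (k * s) :: 'a :: semiring_1 mat)"
proof (rule eq_matI)
  fix i j assume "i < dim_row (1\<^sub>m (k*s) :: 'a mat)" "j < dim_col (1\<^sub>m (k * s) :: 'a mat)"
  then have ij: "i < k * s" "j < k * s" by auto
  then have s: "0 < s" by (cases s) auto
  have "i = j \<longleftrightarrow> i div s = j div s \<and> i mod s = j mod s" by (metis div_mult_mod_eq)
  then show "kron (1\<^sub>m k) (1\<^sub>m s) $$ (i, j) = (1\<^sub>m (k * s) :: 'a mat) $$ (i, j)"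
    using ij s by (auto simp: kron_def less_mult_imp_div_less)
qed auto

lemma kron_transpose: "(kron U V)\<^sup>T = kron (U\<^sup>T) (V\<^sup>T)"
proof (rule eq_matI)
  fix i j assume "i < dim_row (kron (U\<^sup>T) (V\<^sup>T))" "j < dim_col (kron (U\<^sup>T) (V\<^sup>T))"
  then have ij: "i < dim_col U * dim_col V" "j < dim_row U * dim_row V" by auto
  then have "0 < dim_col V" "0 < dim_row V" by (metis mult_0_right neq0_conv not_less0)+
  then show "(kron U V)\<^sup>T $$ (i, j) = kron (U\<^sup>T) (V\<^sup>T) $$ (i, j)"
    using ij by (simp add: kron_def less_mult_imp_div_less)
qed auto

lemma kron_add_left:
  assumes "dim_row U = dim_row V" "dim_col U = dim_col V"
  shows "kron (U + V) D = kron U D + kron V D"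
proof (rule eq_matI)
  fix i j assume "i < dim_row (kron U D + kron V D)" "j < dim_col (kron U D + kron V D)"
  then have ij: "i < dim_row V * dim_row D" "j < dim_col V * dim_col D" using assms by auto
  then show "kron (U + V) D $$ (i, j) = (kron U D + kron V D) $$ (i, j)"
    using assms by (simp add: kron_def less_mult_imp_div_less distrib_right)
qed (use assms in auto)

text \<open>Index arithmetic behind the product of two Kronecker products: \<open>k < p * s\<close> is encoded as the
  pair of its quotient and remainder modulo \<open>s\<close>.\<close>

lemma sum_div_mod:
  "(\<Sum>k<p * s. f (k div s) (k mod s)) = (\<Sum>a<p. \<Sum>b<(s::nat). f a b :: 'a :: comm_monoid_add)"
proof -
  have "(\<Sum>a<p. \<Sum>b<s. f a b) = (\<Sum>(a, b)\<in>{..<p} \<times> {..<s}. f a b)"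
    by (simp add: sum.cartesian_product)
  also have "\<dots> = (\<Sum>k<p * s. f (k div s) (k mod s))"
  proof (rule sum.reindex_bij_witness[of _ "\<lambda>k. (k div s, k mod s)" "\<lambda>(a, b). a * s + b"], goal_cases)
    case (1 x) then show ?case by (auto simp: less_mult_imp_div_less)
  next
    case (2 x)
    then obtain a b where x: "x = (a, b)" "a < p" "b < s" by auto
    have "a * s + b < Suc a * s" using x by simp
    also have "\<dots> \<le> p * s" using x by (intro mult_le_mono1) simp
    finally show ?case using x by simp
  next
    case (4 k)
    then have "0 < s" by (cases s) auto
    then show ?case using 4 by (auto simp: less_mult_imp_div_less)
  qed auto
  finally show ?thesis by simp
qed

lemma kron_one_mult:
  assumes "dim_col U = dim_row V"
  shows "kron U (1\<^sub>m s) * kron V (1\<^sub>m s) = kron (U * V) (1\<^sub>m s :: 'a :: comm_semiring_1 mat)"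
proof (rule eq_matI)
  fix i j assume "i < dim_row (kron (U * V) (1\<^sub>m s))" "j < dim_col (kron (U * V) (1\<^sub>m s))"
  then have ij: "i < dim_row U * s" "j < dim_col V * s" by auto
  then have s: "0 < s" by (cases s) auto
  have "(kron U (1\<^sub>m s) * kron V (1\<^sub>m s)) $$ (i, j) =
      (\<Sum>k<dim_row V * s. kron U (1\<^sub>m s) $$ (i, k) * kron V (1\<^sub>m s) $$ (k, j))"
    using ij assms by (simp add: scalar_prod_def lessThan_atLeast0)
  also have "\<dots> = (\<Sum>k<dim_row V * s. (\<lambda>a b. U $$ (i div s, a) * (1\<^sub>m s $$ (i mod s, b)) *
      (V $$ (a, j div s) * (1\<^sub>m s $$ (b, j mod s)))) (k div s) (k mod s))"
    using ij assms by (intro sum.cong refl) (simp add: kron_def)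
  also have "\<dots> = (\<Sum>a<dim_row V. \<Sum>b<s. U $$ (i div s, a) * (1\<^sub>m s $$ (i mod s, b)) *
      (V $$ (a, j div s) * (1\<^sub>m s $$ (b, j mod s))))"
    by (rule sum_div_mod)
  also have "\<dots> = (\<Sum>a<dim_row V. \<Sum>b<s. if b = i mod s then
      U $$ (i div s, a) * (V $$ (a, j div s) * (1\<^sub>m s $$ (b, j mod s))) else 0)"
    using s by (intro sum.cong refl) (simp)
  also have "\<dots> = (\<Sum>a<dim_row V. U $$ (i div s, a) * (V $$ (a, j div s) * (1\<^sub>m s $$ (i mod s, j mod s))))"
    using s by simp
  also have "\<dots> = (\<Sum>a<dim_row V. U $$ (i div s, a) * V $$ (a, j div s)) * (1\<^sub>m s $$ (i mod s, j mod s))"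
    by (simp add: sum_distrib_right mult.assoc)
  also have "\<dots> = kron (U * V) (1\<^sub>m s) $$ (i, j)"
    using ij assms by (simp add: kron_def scalar_prod_def lessThan_atLeast0 less_mult_imp_div_less)
  finally show "(kron U (1\<^sub>m s) * kron V (1\<^sub>m s)) $$ (i, j) = kron (U * V) (1\<^sub>m s) $$ (i, j)" .
qed (use assms in auto)

text \<open>The quotient \<open>s\<close> may be 0: then \<open>V\<close> has no rows and both sides have no rows either,
  which covers the case of absent noise blocks.\<close>

lemma stp_kron_left:
  assumes "dim_row V = s * dim_col U" "0 < dim_col U"
  shows "U \<ltimes> V = kron U (1\<^sub>m s) * V"
proof (cases "s = 1")
  case True then show ?thesis using assms by (simp add: stp_def kron_one_right[simplified])
next
  case False
  then have "dim_col U \<noteq> dim_row V" using assms by simp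
  then show ?thesis using assms by (simp add: stp_def)
qed

text \<open>For \<open>s > 1\<close> the first divisibility case of the semi-tensor product fails for reasons of size;
  for \<open>s = 0\<close> it fails because 0 divides only 0.\<close>

lemma stp_kron_right:
  assumes "dim_col U = s * dim_row V" "0 < dim_row V"
  shows "U \<ltimes> V = U * kron V (1\<^sub>m s)"
proof (cases "s = 1")
  case True then show ?thesis using assms by (simp add: stp_def kron_one_right[simplified])
next
  case False
  then have 1: "dim_col U \<noteq> dim_row V" using assms by simp
  have 2: "\<not> dim_col U dvd dim_row V"
  proof
    assume "dim_col U dvd dim_row V"
    then have "s * dim_row V \<le> 1 * dim_row V" "s \<noteq> 0" using assms by (auto dest!: dvd_imp_le)
    then show False using False assms by simp
  qed
  show ?thesis using 1 2 assms by (simp add: stp_def)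
qed

section \<open>The algebraic identities\<close>

text \<open>Substituting \<open>N = H + y b\<^sup>T\<close> turns \<open>b + N\<^sup>T V y\<close> into \<open>b R + q\<close> with \<open>q = H\<^sup>T V y\<close>. The
  quadratic term then becomes \<open>b R b\<^sup>T + b q\<^sup>T + q b\<^sup>T + q R\<^sup>-\<^sup>1 q\<^sup>T\<close>, whose first three summands
  cancel against the terms of \<open>b b\<^sup>T + N\<^sup>T V N\<close> that contain \<open>b\<close>.\<close>

lemma complete_square:
  fixes H V y b Ri :: "'a :: comm_ring_1 mat"
  assumes c: "H \<in> carrier_mat k n" "V \<in> carrier_mat k k" "y \<in> carrier_mat k m" "b \<in> carrier_mat n m"
    "Ri \<in> carrier_mat m m"
    and V: "V\<^sup>T = V" and R: "R = 1\<^sub>m m + y\<^sup>T * V * y" "R * Ri = 1\<^sub>m m" "Ri * R = 1\<^sub>m m"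
    and N: "N = H + y * b\<^sup>T"
  shows "b * b\<^sup>T + N\<^sup>T * V * N - (b + N\<^sup>T * V * y) * Ri * (b + N\<^sup>T * V * y)\<^sup>T
    = H\<^sup>T * (V - V * y * Ri * y\<^sup>T * V) * H"
proof -
  note d = carrier_matD[OF c(1)] carrier_matD[OF c(2)] carrier_matD[OF c(3)] carrier_matD[OF c(4)] carrier_matD[OF c(5)]
  have dR: "dim_row R = m" "dim_col R = m" using d by (simp_all add: R)
  have RT: "R\<^sup>T = R" using d V by (simp add: R mat_expand)
  define q where "q = H\<^sup>T * V * y"
  have dq: "dim_row q = n" "dim_col q = m" using d by (simp_all add: q_def)
  have e: "b + N\<^sup>T * V * y = b * R + q"
    using d by (intro eq_matI) (simp_all add: q_def N R mat_expand V del: index_mult_mat(1))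
  have "(b * R + q) * Ri * (b * R + q)\<^sup>T = b * R * b\<^sup>T + b * q\<^sup>T + q * b\<^sup>T + q * Ri * q\<^sup>T"
    using d dR dq
    by (intro eq_matI) (simp_all add: RT mat_expand R(2,3) mult_cancel_left_inverse[OF R(2)]
      mult_cancel_left_inverse[OF R(3)] del: index_mult_mat(1))
  then show ?thesis unfolding e
    using d by (intro eq_matI) (simp_all add: q_def N R(1) mat_expand V del: index_mult_mat(1))
qed

text \<open>The Sherman--Morrison--Woodbury formula for the inverse of \<open>V\<^sup>-\<^sup>1 + y y\<^sup>T\<close>, where \<open>VI\<close> stands
  for \<open>V\<^sup>-\<^sup>1\<close> and \<open>Ri\<close> for the inverse of the small matrix \<open>I + y\<^sup>T V y\<close>.\<close>

lemma woodbury: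
  fixes V VI y Ri :: "'a :: comm_ring_1 mat"
  assumes c: "V \<in> carrier_mat k k" "VI \<in> carrier_mat k k" "y \<in> carrier_mat k m" "Ri \<in> carrier_mat m m"
    and inv: "V * VI = 1\<^sub>m k" and R: "Ri * (1\<^sub>m m + y\<^sup>T * V * y) = 1\<^sub>m m"
  shows "(V - V * y * Ri * y\<^sup>T * V) * (VI + y * y\<^sup>T) = 1\<^sub>m k"
proof -
  note d = carrier_matD[OF c(1)] carrier_matD[OF c(2)] carrier_matD[OF c(3)] carrier_matD[OF c(4)]
  have "V * y * (Ri * (1\<^sub>m m + y\<^sup>T * V * y)) * y\<^sup>T = V * y * y\<^sup>T"
    using d unfolding R by (simp add: mat_expand)
  then have eq: "V * (y * (Ri * y\<^sup>T)) + V * (y * (Ri * (y\<^sup>T * (V * (y * y\<^sup>T))))) = V * (y * y\<^sup>T)"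
    using d by (simp add: mat_expand)
  have "(V * (y * y\<^sup>T)) $$ (i, j) =
      (V * (y * (Ri * y\<^sup>T))) $$ (i, j) + (V * (y * (Ri * (y\<^sup>T * (V * (y * y\<^sup>T)))))) $$ (i, j)"
    if "i < k" "j < k" for i j
    using d that by (subst eq[symmetric]) (simp del: index_mult_mat(1))
  then show ?thesis
    using d by (intro eq_matI) (simp_all add: mat_expand inv del: index_mult_mat(1))
qed

lemma append_rows_gram:
  assumes "U \<in> carrier_mat a n" "V \<in> carrier_mat b n"
  shows "(U @\<^sub>r V)\<^sup>T * (U @\<^sub>r V) = U\<^sup>T * U + V\<^sup>T * (V :: 'a :: comm_ring_1 mat)"
proof -
  have UV: "U @\<^sub>r V = four_block_mat U (0\<^sub>m a 0) V (0\<^sub>m b 0)"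
    using assms by (auto simp: append_rows_def)
  have UVT: "(four_block_mat U (0\<^sub>m a 0) V (0\<^sub>m b 0))\<^sup>T = four_block_mat (U\<^sup>T) (V\<^sup>T) (0\<^sub>m 0 a) (0\<^sub>m 0 b)"
    using assms by (simp add: transpose_four_block_mat[of _ a n _ 0 _ b])
  show ?thesis unfolding UV UVT using assms
    by (subst mult_four_block_mat[of _ n a _ b _ 0 _ _ n _ 0]) (auto intro!: eq_matI)
qed

text \<open>Put \<open>K = C G\<close>. Since \<open>G\<close> inverts \<open>A - g I\<close>, \<open>K A = C + g K\<close>, which removes \<open>A\<close> from the
  left-hand side. What remains to be matched is \<open>4 g\<^sup>2 K\<^sup>T (W - W W) K\<close> with
  \<open>X B B\<^sup>T X = 4 g\<^sup>2 K\<^sup>T W Y Y\<^sup>T W K\<close>, and this is the definition of \<open>W\<close> as the inverse of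
  \<open>I + Y Y\<^sup>T\<close>, multiplied by \<open>W\<close> on both sides.\<close>

lemma shifted_lyapunov:
  fixes C A G B W :: "real mat" and g :: real
  assumes c: "C \<in> carrier_mat l n" "A \<in> carrier_mat n n" "G \<in> carrier_mat n n" "B \<in> carrier_mat n m"
      "W \<in> carrier_mat l l"
    and G: "(A - g \<cdot>\<^sub>m 1\<^sub>m n) * G = 1\<^sub>m n" "G * (A - g \<cdot>\<^sub>m 1\<^sub>m n) = 1\<^sub>m n"
    and Y: "Y = C * G * B"
    and W: "W * (1\<^sub>m l + Y * Y\<^sup>T) = 1\<^sub>m l" "W\<^sup>T = W"
    and X: "X = (2 * g) \<cdot>\<^sub>m (G\<^sup>T * C\<^sup>T * W * C * G)"
    and U: "U = C + (2 * g) \<cdot>\<^sub>m (W * C * G)"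
  shows "C\<^sup>T * C + A\<^sup>T * X + X * A = U\<^sup>T * U + (X * B) * (X * B)\<^sup>T"
proof -
  note d = carrier_matD[OF c(1)] carrier_matD[OF c(2)] carrier_matD[OF c(3)] carrier_matD[OF c(4)] carrier_matD[OF c(5)]
  define K where "K = C * G"
  have dK: "dim_row K = l" "dim_col K = n" using d by (simp_all add: K_def)
  have "C * (G * (A - g \<cdot>\<^sub>m 1\<^sub>m n)) = C" using d by (simp add: G mat_expand)
  then have "C + g \<cdot>\<^sub>m K = (C * (G * A) - g \<cdot>\<^sub>m K) + g \<cdot>\<^sub>m K" using d by (simp add: mat_expand K_def)
  then have KA: "K * A = C + g \<cdot>\<^sub>m K" using d by (simp add: K_def mat_expand) (auto intro!: eq_matI simp del: index_mult_mat(1))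
  have AK: "A\<^sup>T * K\<^sup>T = C\<^sup>T + g \<cdot>\<^sub>m K\<^sup>T"
    using arg_cong[OF KA, of transpose_mat] d dK by (simp add: mat_expand)
  have AK': "A\<^sup>T * (K\<^sup>T * Z) = C\<^sup>T * Z + g \<cdot>\<^sub>m (K\<^sup>T * Z)" if "dim_row Z = l" for Z
  proof -
    have "A\<^sup>T * (K\<^sup>T * Z) = A\<^sup>T * K\<^sup>T * Z" using d dK that by (simp add: mat_expand)
    then show ?thesis using d dK that unfolding AK by (simp add: mat_expand)
  qed
  have X': "X = (2 * g) \<cdot>\<^sub>m (K\<^sup>T * W * K)" using d by (simp add: X K_def mat_expand)
  have U': "U = C + (2 * g) \<cdot>\<^sub>m (W * K)" using d by (simp add: U K_def mat_expand)
  have Y': "Y = K * B" by (simp add: Y K_def)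
  have "W * (1\<^sub>m l + Y * Y\<^sup>T) * W = W" using d by (simp add: W mat_expand)
  then have WYW: "W = W * W + W * (Y * (Y\<^sup>T * W))" using d by (simp add: Y' K_def mat_expand)
  have "K\<^sup>T * W * K = K\<^sup>T * W * W * K + K\<^sup>T * W * Y * Y\<^sup>T * W * K"
    using d dK by (subst WYW) (simp add: Y' mat_expand)
  then have key: "K\<^sup>T * (W * K) = K\<^sup>T * (W * (W * K)) + K\<^sup>T * (W * (K * (B * (B\<^sup>T * (K\<^sup>T * (W * K))))))"
    using d dK by (simp add: Y' mat_expand)
  have XB: "(X * B) * (X * B)\<^sup>T = (4 * (g * g)) \<cdot>\<^sub>m (K\<^sup>T * (W * (K * (B * (B\<^sup>T * (K\<^sup>T * (W * K)))))))"
    using d dK by (simp add: X' mat_expand W)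
  have UU: "U\<^sup>T * U = C\<^sup>T * C + (2 * g) \<cdot>\<^sub>m (C\<^sup>T * (W * K)) + (2 * g) \<cdot>\<^sub>m (K\<^sup>T * (W * C))
      + (4 * (g * g)) \<cdot>\<^sub>m (K\<^sup>T * (W * (W * K)))"
    using d dK by (intro eq_matI) (simp_all add: U' mat_expand W del: index_mult_mat(1))
  have L: "C\<^sup>T * C + A\<^sup>T * X + X * A = C\<^sup>T * C + (2 * g) \<cdot>\<^sub>m (C\<^sup>T * (W * K)) + (2 * g) \<cdot>\<^sub>m (K\<^sup>T * (W * C))
      + (4 * (g * g)) \<cdot>\<^sub>m (K\<^sup>T * (W * K))"
    using d dK by (intro eq_matI) (simp_all add: X' mat_expand KA AK' del: index_mult_mat(1))
  show ?thesis unfolding L UU XB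
    using d dK by (subst key) (intro eq_matI; simp add: mat_expand algebra_simps del: index_mult_mat(1))
qed

section \<open>The residual\<close>

lemma stack_rows_carrier:
  assumes "\<And>i. i < r \<Longrightarrow> M i \<in> carrier_mat n c"
  shows "stack_rows r c M \<in> carrier_mat ((r - 1) * n) c"
proof -
  have "foldr (@\<^sub>r) (map M xs) (0\<^sub>m 0 c) \<in> carrier_mat (length xs * n) c" if "set xs \<subseteq> {..<r}" for xs
    using that by (induction xs) (auto intro!: carrier_append_rows assms)
  moreover have "set [1..<r] \<subseteq> {..<r}" by auto
  ultimately have "foldr (@\<^sub>r) (map M [1..<r]) (0\<^sub>m 0 c) \<in> carrier_mat (length [1..<r] * n) c" by blast
  then show ?thesis by (simp add: stack_rows_def)
qed

lemma stp_eq_mult: "dim_col U = dim_row V \<Longrightarrow> U \<ltimes> V = U * V"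
  by (simp add: stp_def)

text \<open>The three identities combined, in terms of the reduced coefficients \<open>A\<close>, \<open>B\<close>, \<open>Ah\<close>, \<open>Bh\<close>
  as given matrices. Here \<open>s\<close> is the number of blocks of \<open>Ah\<close> and \<open>Bh\<close>, which may be 0, \<open>G\<close> is the
  inverse of the shifted coefficient, and \<open>U\<close> and \<open>H\<close> are the upper block and, up to the factor
  \<open>M\<^sup>-\<^sup>1\<close>, the lower block of the factorization.\<close>

lemma residual_iterate:
  fixes n m l s :: nat and C A B Ah Bh G Y Yh W X T U H :: "real mat" and g :: real
  assumes n: "n \<ge> 1" and l: "l \<ge> 1"
    and C: "C \<in> carrier_mat l n" and A: "A \<in> carrier_mat n n" and B: "B \<in> carrier_mat n m"
    and Ah: "Ah \<in> carrier_mat (s * n) n" and Bh: "Bh \<in> carrier_mat (s * n) m"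
    and g: "g > 0" and inv: "invertible_mat (A - g \<cdot>\<^sub>m 1\<^sub>m n)"
    and G_def: "G = minv (A - g \<cdot>\<^sub>m 1\<^sub>m n)"
    and Y_def: "Y = C * G * B"
    and T_def: "T = sqrt (2 * g) \<cdot>\<^sub>m (C * G)"
    and Yh_def: "Yh = T \<ltimes> Bh"
    and W_def: "W = minv (1\<^sub>m l + Y * Y\<^sup>T)"
    and X_def: "X = (2 * g) \<cdot>\<^sub>m (G\<^sup>T * C\<^sup>T * W * C * G)"
    and U_def: "U = C + (2 * g) \<cdot>\<^sub>m (W * C * G)"
    and H_def: "H = T \<ltimes> Ah - Yh * B\<^sup>T * X"
  shows "pos_semidef X" "residual_domain n Bh X" "invertible_mat (1\<^sub>m l + Y * Y\<^sup>T)"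
    and "\<And>M. M \<in> carrier_mat (s * l) (s * l) \<Longrightarrow>
      M * M\<^sup>T = 1\<^sub>m (s * l) + kron (Y * Y\<^sup>T) (1\<^sub>m s) + Yh * Yh\<^sup>T \<Longrightarrow>
      invertible_mat M \<and>
      U @\<^sub>r (minv M * H) \<in> carrier_mat (l + s * l) n \<and>
      residual C A B Ah Bh X =
        (U @\<^sub>r (minv M * H))\<^sup>T * (U @\<^sub>r (minv M * H))"
    and "\<And>PX. PX \<in> carrier_mat m m \<Longrightarrow> PX\<^sup>T * PX = R_mat Bh X \<Longrightarrow>
      invertible_mat PX \<and>
      (L_mat B Ah Bh X PX)\<^sup>T = (minv PX)\<^sup>T * Yh\<^sup>T \<ltimes> W \<ltimes> H + PX * B\<^sup>T * X"
proof -
  have Ag: "A - g \<cdot>\<^sub>m 1\<^sub>m n \<in> carrier_mat n n" using A by auto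
  note G = minv[OF Ag inv, folded G_def]
  note d = carrier_matD[OF C] carrier_matD[OF A] carrier_matD[OF B] carrier_matD[OF Ah]
    carrier_matD[OF Bh] carrier_matD[OF G(1)]
  have dY: "dim_row Y = l" "dim_col Y = m" using d by (simp_all add: Y_def)
  have dT: "dim_row T = l" "dim_col T = n" using d by (simp_all add: T_def)

  define S where "S = 1\<^sub>m l + Y * Y\<^sup>T"
  have S: "S \<in> carrier_mat l l" using dY by (intro carrier_matI) (simp_all add: S_def)
  have YY: "Y * Y\<^sup>T \<in> carrier_mat l l" using dY by (intro carrier_matI) simp_all
  have S_psd: "pos_semidef S" unfolding S_def
    using dY by (intro pos_semidef_add pos_semidef_one pos_semidef_gram) simp
  show S_inv: "invertible_mat (1\<^sub>m l + Y * Y\<^sup>T)"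
    by (rule one_plus_pos_semidef_invertible[OF pos_semidef_gram(2) YY])
  note W = minv[OF S S_inv[folded S_def], folded W_def[folded S_def]]
  have dW: "dim_row W = l" "dim_col W = l" using W(1) by simp_all
  have W_psd: "pos_semidef W" by (rule pos_semidef_inverse[OF S_psd S W(1,2)])
  have WT: "W\<^sup>T = W" using W_psd by (simp add: pos_semidef_def)

  have sq: "sqrt (2 * g) * sqrt (2 * g) = 2 * g" using g by simp
  have X: "X = T\<^sup>T * W * T" using d dW g by (simp add: X_def T_def mat_expand sq)
  have dX: "dim_row X = n" "dim_col X = n" using dT by (simp_all add: X)
  show X_psd: "pos_semidef X" unfolding X using dT dW by (intro pos_semidef_congruence[OF W_psd]) simp
  have XT: "X\<^sup>T = X" using X_psd by (simp add: pos_semidef_def)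

  define V where "V = kron W (1\<^sub>m s)"
  define VI where "VI = kron S (1\<^sub>m s)"
  have dV: "dim_row V = s * l" "dim_col V = s * l" using dW by (simp_all add: V_def)
  have dVI: "dim_row VI = s * l" "dim_col VI = s * l" using S by (simp_all add: VI_def)
  have V: "V \<in> carrier_mat (s * l) (s * l)" and VI: "VI \<in> carrier_mat (s * l) (s * l)"
    using dV dVI by auto
  have VT: "V\<^sup>T = V" by (simp add: V_def kron_transpose WT)
  have V_VI: "V * VI = 1\<^sub>m (s * l)" "VI * V = 1\<^sub>m (s * l)"
    using S dW W(2,3) unfolding V_def VI_def
    by (simp_all add: kron_one_mult kron_one_one mult.commute)
  have VI_eq: "VI = 1\<^sub>m (s * l) + kron (Y * Y\<^sup>T) (1\<^sub>m s)"
    using dY unfolding VI_def S_def by (simp add: kron_add_left kron_one_one mult.commute)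
  have kYY: "kron (Y * Y\<^sup>T) (1\<^sub>m s) = kron Y (1\<^sub>m s) * (kron Y (1\<^sub>m s))\<^sup>T"
    by (simp add: kron_transpose kron_one_mult)
  have kYY_psd: "pos_semidef (kron (Y * Y\<^sup>T) (1\<^sub>m s))"
    unfolding kYY by (rule pos_semidef_gram)
  have VI_psd: "pos_semidef VI" unfolding VI_eq
    using dY by (intro pos_semidef_add pos_semidef_one kYY_psd) simp
  have V_psd: "pos_semidef V" by (rule pos_semidef_inverse[OF VI_psd VI V V_VI(2)])

  define K where "K = kron T (1\<^sub>m s)"
  have dK: "dim_row K = s * l" "dim_col K = s * n" using dT by (simp_all add: K_def)
  define N where "N = K * Ah"
  have y: "Yh = K * Bh" unfolding Yh_def K_def using d dT n by (intro stp_kron_left) simp_all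
  have N: "T \<ltimes> Ah = N" unfolding N_def K_def using d dT n by (intro stp_kron_left) simp_all
  have dN: "dim_row N = s * l" "dim_col N = n" using dK d by (simp_all add: N_def)
  have dy: "dim_row Yh = s * l" "dim_col Yh = m" using dK d by (simp_all add: y)
  have dH: "dim_row H = s * l" "dim_col H = n" using dN dy d dX by (simp_all add: H_def N)
  have kX: "kron X (1\<^sub>m s) = K\<^sup>T * V * K"
    using dT dW by (simp add: X K_def V_def kron_transpose kron_one_mult)
  \<comment> \<open>the only place where semi-tensor products with \<open>X\<close> are evaluated; every middle term factors through \<open>K\<close>\<close>
  have sandwich: "U\<^sup>T \<ltimes> X \<ltimes> Z = (K * U)\<^sup>T * V * (K * Z)"
    if "dim_row U = s * n" "dim_row Z = s * n" for U Z
  proof -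
    have "U\<^sup>T \<ltimes> X = U\<^sup>T * kron X (1\<^sub>m s)" using that dX n by (intro stp_kron_right) simp_all
    moreover have "U\<^sup>T * kron X (1\<^sub>m s) \<ltimes> Z = U\<^sup>T * kron X (1\<^sub>m s) * Z"
      using that dX by (intro stp_eq_mult) (simp add: mult.commute)
    ultimately show ?thesis using that dK dV by (simp add: kX mat_expand)
  qed
  have sAA: "Ah\<^sup>T \<ltimes> X \<ltimes> Ah = N\<^sup>T * V * N" using sandwich[of Ah Ah] d by (simp add: N_def)
  have sAB: "Ah\<^sup>T \<ltimes> X \<ltimes> Bh = N\<^sup>T * V * Yh" using sandwich[of Ah Bh] d by (simp add: N_def y)

  define R where "R = 1\<^sub>m m + Yh\<^sup>T * V * Yh"
  have R_mat: "R_mat Bh X = R" using sandwich[of Bh Bh] d by (simp add: R_mat_def R_def y)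
  have R: "R \<in> carrier_mat m m" using dy by (intro carrier_matI) (simp_all add: R_def)
  have R_inv: "invertible_mat R" unfolding R_def
    using dy dV by (intro one_plus_pos_semidef_invertible pos_semidef_congruence[OF V_psd] carrier_matI) simp_all
  show "residual_domain n Bh X"
    using dX XT R_inv R_mat by (auto simp: residual_domain_def)
  define Ri where "Ri = minv R"
  note Ri = minv[OF R R_inv, folded Ri_def]
  define b where "b = X * B"
  have db: "dim_row b = n" "dim_col b = m" using dX d by (simp_all add: b_def)
  have bT: "b\<^sup>T = B\<^sup>T * X" using dX d by (simp add: b_def mat_expand XT)
  have NH: "N = H + Yh * b\<^sup>T" unfolding H_def N bT
    using dN dy d dX by (intro eq_matI) (simp_all add: mat_expand del: index_mult_mat(1))
  have Hc: "H \<in> carrier_mat (s * l) n" and yc: "Yh \<in> carrier_mat (s * l) m" and bc: "b \<in> carrier_mat n m"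
    using dH dy db by auto

  show "invertible_mat M \<and>
      U @\<^sub>r (minv M * H) \<in> carrier_mat (l + s * l) n \<and>
      residual C A B Ah Bh X =
        (U @\<^sub>r (minv M * H))\<^sup>T * (U @\<^sub>r (minv M * H))"
    if M: "M \<in> carrier_mat (s * l) (s * l)"
      and MM: "M * M\<^sup>T = 1\<^sub>m (s * l) + kron (Y * Y\<^sup>T) (1\<^sub>m s) + Yh * Yh\<^sup>T" for M
  proof -
    have MM_VI: "M * M\<^sup>T = VI + Yh * Yh\<^sup>T" by (simp add: MM VI_eq)
    have "M * M\<^sup>T = 1\<^sub>m (s * l) + (kron (Y * Y\<^sup>T) (1\<^sub>m s) + Yh * Yh\<^sup>T)"
      unfolding MM using dY dy by (intro eq_matI) (simp_all add: mult.commute del: index_mult_mat(1))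
    moreover have "invertible_mat (1\<^sub>m (s * l) + (kron (Y * Y\<^sup>T) (1\<^sub>m s) + Yh * Yh\<^sup>T))"
      using dY dy
      by (intro one_plus_pos_semidef_invertible pos_semidef_add kYY_psd pos_semidef_gram carrier_matI) simp_all
    ultimately have "invertible_mat (M * M\<^sup>T)" by simp
    then have M_inv: "invertible_mat M"
      using M by (intro invertible_of_invertible_mult(1)[of M "s * l" "M\<^sup>T"]) auto
    define Mi where "Mi = minv M"
    note Mi = minv[OF M M_inv, folded Mi_def]
    have dM: "dim_row M = s * l" "dim_col M = s * l" "dim_row Mi = s * l" "dim_col Mi = s * l"
      using M Mi(1) by auto
    define D where "D = V - V * Yh * Ri * Yh\<^sup>T * V"
    have dD: "dim_row D = s * l" "dim_col D = s * l" using dV by (simp_all add: D_def)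
    \<comment> \<open>\<open>D\<close> and \<open>Mi\<^sup>T * Mi\<close> are a left and a right inverse of \<open>M * M\<^sup>T\<close>, hence equal\<close>
    have D: "D * (M * M\<^sup>T) = 1\<^sub>m (s * l)" unfolding D_def MM_VI
      using Ri(3) by (intro woodbury[OF V VI yc Ri(1) V_VI(1)]) (simp add: R_def)
    have "M\<^sup>T * Mi\<^sup>T = 1\<^sub>m (s * l)" using arg_cong[OF Mi(3), of transpose_mat] dM
      by (simp add: transpose_mult_dim)
    then have "M * M\<^sup>T * (Mi\<^sup>T * Mi) = 1\<^sub>m (s * l)"
      using dM by (simp add: mat_expand mult_cancel_left_inverse Mi(2))
    moreover have "D * (M * M\<^sup>T * (Mi\<^sup>T * Mi)) = D * (M * M\<^sup>T) * (Mi\<^sup>T * Mi)"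
      using dM dD by (simp add: mult_assoc_dim)
    ultimately have D_eq: "D = Mi\<^sup>T * Mi" using D dD dM by (simp add: mult_one_dim one_mult_dim)

    have Uc: "U \<in> carrier_mat l n" using d dW by (intro carrier_matI) (simp_all add: U_def)
    have MH: "Mi * H \<in> carrier_mat (s * l) n" using dM dH by (intro carrier_matI) simp_all
    have lyap: "C\<^sup>T * C + A\<^sup>T * X + X * A = U\<^sup>T * U + b * b\<^sup>T"
      unfolding b_def
      by (rule shifted_lyapunov[OF C A G(1) B W(1) G(2,3) Y_def W(3)[unfolded S_def] WT X_def U_def])
    have "residual C A B Ah Bh X = U\<^sup>T * U + b * b\<^sup>T + N\<^sup>T * V * N
        - (b + N\<^sup>T * V * Yh) * Ri * (b + N\<^sup>T * V * Yh)\<^sup>T"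
      by (simp add: residual_def sAA sAB R_mat Ri_def b_def lyap[unfolded b_def])
    also have "\<dots> = U\<^sup>T * U + (b * b\<^sup>T + N\<^sup>T * V * N
        - (b + N\<^sup>T * V * Yh) * Ri * (b + N\<^sup>T * V * Yh)\<^sup>T)"
      using Uc db dN by (intro eq_matI) (simp_all del: index_mult_mat(1))
    also have "b * b\<^sup>T + N\<^sup>T * V * N - (b + N\<^sup>T * V * Yh) * Ri * (b + N\<^sup>T * V * Yh)\<^sup>T = H\<^sup>T * D * H"
      unfolding D_def by (rule complete_square[OF Hc V yc bc Ri(1) VT R_def Ri(2,3) NH])
    also have "H\<^sup>T * D * H = (Mi * H)\<^sup>T * (Mi * H)"
      using dM dH by (simp add: D_eq mat_expand)
    also have "U\<^sup>T * U + (Mi * H)\<^sup>T * (Mi * H) = (U @\<^sub>r (Mi * H))\<^sup>T * (U @\<^sub>r (Mi * H))"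
      by (rule append_rows_gram[OF Uc MH, symmetric])
    finally show ?thesis using M_inv carrier_append_rows[OF Uc MH]
      unfolding Mi_def by blast
  qed

  show "invertible_mat PX \<and>
      (L_mat B Ah Bh X PX)\<^sup>T = (minv PX)\<^sup>T * Yh\<^sup>T \<ltimes> W \<ltimes> H + PX * B\<^sup>T * X"
    if P: "PX \<in> carrier_mat m m" and PP: "PX\<^sup>T * PX = R_mat Bh X" for PX
  proof -
    have P_inv: "invertible_mat PX"
      using P PP R_inv R_mat by (intro invertible_of_invertible_mult(2)[of "PX\<^sup>T" m PX]) auto
    define Pi where "Pi = minv PX"
    note Pi = minv[OF P P_inv, folded Pi_def]
    have dP: "dim_row PX = m" "dim_col PX = m" "dim_row Pi = m" "dim_col Pi = m" using P Pi(1) by auto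
    have PiP: "Pi\<^sup>T * PX\<^sup>T = 1\<^sub>m m" using arg_cong[OF Pi(2), of transpose_mat] dP
      by (simp add: transpose_mult_dim)
    have sBA: "(Bh * Pi)\<^sup>T \<ltimes> X \<ltimes> Ah = Pi\<^sup>T * Yh\<^sup>T * V * N"
      using sandwich[of "Bh * Pi" Ah] d dP dK dV by (simp add: N_def y mat_expand)
    \<comment> \<open>the factor \<open>R = PX\<^sup>T * PX\<close> of \<open>b R + H\<^sup>T V Yh\<close> absorbs the inverse of \<open>PX\<^sup>T\<close>\<close>
    have "Pi\<^sup>T * (R * b\<^sup>T) = Pi\<^sup>T * (PX\<^sup>T * (PX * b\<^sup>T))"
      unfolding R_mat[symmetric] PP[symmetric] using dP db by (simp add: mult_assoc_dim)
    also have "\<dots> = PX * b\<^sup>T" using dP by (intro mult_cancel_left_inverse[OF PiP]) simp_all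
    finally have key: "PX * b\<^sup>T = Pi\<^sup>T * (R * b\<^sup>T)" ..
    have "(L_mat B Ah Bh X PX)\<^sup>T = Pi\<^sup>T * b\<^sup>T + Pi\<^sup>T * Yh\<^sup>T * V * N"
      using dP d dX unfolding L_mat_def Pi_def[symmetric] sBA by (simp add: bT mat_expand)
    also have "\<dots> = Pi\<^sup>T * Yh\<^sup>T * V * H + Pi\<^sup>T * (R * b\<^sup>T)"
      unfolding NH R_def using dP db dy dV dH
      by (intro eq_matI) (simp_all add: mat_expand del: index_mult_mat(1))
    also have "Pi\<^sup>T * (R * b\<^sup>T) = PX * B\<^sup>T * X"
      unfolding key[symmetric] unfolding bT using dP d dX by (simp add: mat_expand)
    also have "Pi\<^sup>T * Yh\<^sup>T * V * H = Pi\<^sup>T * Yh\<^sup>T \<ltimes> W \<ltimes> H"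
    proof -
      have "Pi\<^sup>T * Yh\<^sup>T \<ltimes> W = Pi\<^sup>T * Yh\<^sup>T * V"
        unfolding V_def using dy dW l by (intro stp_kron_right) simp_all
      moreover have "Pi\<^sup>T * Yh\<^sup>T * V \<ltimes> H = Pi\<^sup>T * Yh\<^sup>T * V * H"
        using dV dH by (intro stp_eq_mult) simp
      ultimately show ?thesis by simp
    qed
    finally show ?thesis using P_inv by (simp add: Pi_def)
  qed
qed

theorem theorem2p2:
  fixes r n m l :: nat
    and As Bs :: "nat \<Rightarrow> real mat"
    and R L Q P C Perm A B Ah Bh A\<gamma> Y Yh W X :: "real mat"
    and \<gamma> :: real
  assumes "r \<ge> 1" "n \<ge> 1" "m \<ge> 1" "l \<ge> 1"
    and "\<And>i. i < r \<Longrightarrow> As i \<in> carrier_mat n n"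
    and "\<And>i. i < r \<Longrightarrow> Bs i \<in> carrier_mat n m"
    and "R \<in> carrier_mat m m" "L \<in> carrier_mat n m" "Q \<in> carrier_mat n n"
    and "pos_semidef (four_block_mat Q L (L\<^sup>T) R)"
    and "pos_def R"
    and "P \<in> carrier_mat m m" "P\<^sup>T * P = R"
    and "C \<in> carrier_mat l n" "C\<^sup>T * C = Q - L * minv R * L\<^sup>T"
    and "stabilizable n m r As Bs"
    and "detectable n l r As C"
    and "permutation_mat ((r - 1) * n) Perm"
    and "\<And>Z. Z \<in> carrier_mat n n \<Longrightarrow>
           Perm\<^sup>T * kron Z (1\<^sub>m (r - 1)) * Perm = kron (1\<^sub>m (r - 1)) Z"
    and "A = As 0 - Bs 0 * minv R * L\<^sup>T"
    and "B = Bs 0 * minv P"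
    and "Ah = Perm * (stack_rows r n As - stack_rows r m Bs * minv R * L\<^sup>T)"
    and "Bh = Perm * stack_rows r m Bs * minv P"
    and "\<gamma> > 0"
    and "A\<gamma> = A - \<gamma> \<cdot>\<^sub>m 1\<^sub>m n" "invertible_mat A\<gamma>"
    and "Y = C * minv A\<gamma> * B"
    and "Yh = (sqrt (2 * \<gamma>) \<cdot>\<^sub>m (C * minv A\<gamma>)) \<ltimes> Bh"
    and "W = minv (1\<^sub>m l + Y * Y\<^sup>T)"
    and "X = (2 * \<gamma>) \<cdot>\<^sub>m ((minv A\<gamma>)\<^sup>T * C\<^sup>T * W * C * minv A\<gamma>)"
  shows "pos_semidef X \<and> residual_domain n Bh X \<and> invertible_mat (1\<^sub>m l + Y * Y\<^sup>T) \<and>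
    (\<forall>M \<in> carrier_mat ((r - 1) * l) ((r - 1) * l).
       M * M\<^sup>T = 1\<^sub>m ((r - 1) * l) + kron (Y * Y\<^sup>T) (1\<^sub>m (r - 1)) + Yh * Yh\<^sup>T \<longrightarrow>
       invertible_mat M \<and>
       (let Ct = (C + (2 * \<gamma>) \<cdot>\<^sub>m (W * C * minv A\<gamma>))
                 @\<^sub>r (minv M * ((sqrt (2 * \<gamma>) \<cdot>\<^sub>m (C * minv A\<gamma>)) \<ltimes> Ah - Yh * B\<^sup>T * X))
        in Ct \<in> carrier_mat (r * l) n \<and> residual C A B Ah Bh X = Ct\<^sup>T * Ct)) \<and>
    (\<forall>PX \<in> carrier_mat m m.
       PX\<^sup>T * PX = R_mat Bh X \<longrightarrow>
       invertible_mat PX \<and>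
       (L_mat B Ah Bh X PX)\<^sup>T =
         (minv PX)\<^sup>T * Yh\<^sup>T \<ltimes> W \<ltimes> ((sqrt (2 * \<gamma>) \<cdot>\<^sub>m (C * minv A\<gamma>)) \<ltimes> Ah - Yh * B\<^sup>T * X)
         + PX * B\<^sup>T * X)"
proof -
  define s where "s = r - 1"
  have rs: "r * l = l + s * l" using assms(1) by (cases r) (simp_all add: s_def)
  have Pc: "Perm \<in> carrier_mat (s * n) (s * n)"
    using assms(18) by (auto simp: permutation_mat_def s_def)
  have R_inv: "invertible_mat R" by (rule pos_def_invertible[OF assms(11) assms(7)])
  have P_inv: "invertible_mat P"
    using assms(7,12,13) R_inv by (intro invertible_of_invertible_mult(2)[of "P\<^sup>T" m P]) auto
  note Ri = minv(1)[OF assms(7) R_inv] and Pi = minv(1)[OF assms(12) P_inv]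
  have SA: "stack_rows r n As \<in> carrier_mat (s * n) n" unfolding s_def
    by (rule stack_rows_carrier[OF assms(5)])
  have SB: "stack_rows r m Bs \<in> carrier_mat (s * n) m" unfolding s_def
    by (rule stack_rows_carrier[OF assms(6)])
  have A0: "As 0 \<in> carrier_mat n n" and B0: "Bs 0 \<in> carrier_mat n m"
    using assms(1,5,6) by simp_all
  have A: "A \<in> carrier_mat n n" using A0 B0 Ri assms(8) by (intro carrier_matI) (simp_all add: assms(20))
  have B: "B \<in> carrier_mat n m" using B0 Pi by (intro carrier_matI) (simp_all add: assms(21))
  have Ah: "Ah \<in> carrier_mat (s * n) n"
    using Pc SA SB Ri assms(8) by (intro carrier_matI) (simp_all add: assms(22))
  have Bh: "Bh \<in> carrier_mat (s * n) m"
    using Pc SB Pi by (intro carrier_matI) (simp_all add: assms(23))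
  note core = residual_iterate[OF assms(2,4,14) A B Ah Bh assms(24) assms(26)[unfolded assms(25)]
    refl assms(27)[unfolded assms(25)] refl assms(28)[unfolded assms(25)] assms(29)
    assms(30)[unfolded assms(25)] refl refl, folded assms(25)]
  show ?thesis
    unfolding Let_def rs s_def[symmetric]
    using core(1-3) core(4)[simplified] core(5) by auto
qed

end
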